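(* Let $h\geq 3$ be an integer and let $A$ be a finite set of $k\geq 3$ positive integers. If $|h_{\pm}A|=2hk-h+1$, then $A=d*\{1,3,\ldots,2k-1\}$ for some positive integer $d$.
   Context: For a finite set $A=\{a_0,a_1,\ldots,a_{k-1}\}$ of integers and a positive integer $h$, the $h$-fold signed sumset of $A$ is \[h_{\pm}A=\Big\{\sum_{i=0}^{k-1}\lambda_i a_i : (\lambda_0,\ldots,\lambda_{k-1})\in\mathbb{Z}^k,\ \sum_{i=0}^{k-1}|\lambda_i|=h\Big\}.\] For an integer $d$ and a set $B$ of integers, $d*B=\{db : b\in B\}$ denotes the $d$-dilation of $B$. *)

theory Defs
  imports Main
begin

definition signed_sumset :: "nat \<Rightarrow> int set \<Rightarrow> int set" where
  "signed_sumset h A =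
     {(\<Sum>a\<in>A. l a * a) | l :: int \<Rightarrow> int. (\<Sum>a\<in>A. \<bar>l a\<bar>) = int h}"

definition dilation :: "int \<Rightarrow> int set \<Rightarrow> int set" where
  "dilation d B = {d * b | b. b \<in> B}"

end

theory Submission
  imports Defs
begin

text \<open>
  Write \<open>a\<^sub>0 < a\<^sub>1 < \<dots>\<close> for the elements of \<open>A\<close>. Moving from \<open>h a\<^sub>i\<close> to \<open>h a\<^sub>i\<^sub>+\<^sub>1\<close> by
  exchanging one summand at a time yields \<open>h (k - 1) + 1\<close> elements in \<open>[h a\<^sub>0, h a\<^sub>k\<^sub>-\<^sub>1]\<close>, and
  by symmetry as many negative ones; so there is room for only \<open>h - 1\<close> further elements.
  If two consecutive gaps of \<open>A\<close> differ, the corresponding three elements alone produce \<open>h - 1\<close>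
  additional positive sums, hence \<open>2 (h - 1)\<close> in total. So \<open>A\<close> is an arithmetic progression,
  with first term \<open>a\<close> and difference \<open>e\<close>. If \<open>e > 2 a\<close>, the sums of \<open>-a\<close> and \<open>h - 1\<close> summands from
  \<open>{a + e, a + 2 e}\<close> are \<open>h\<close> positive elements that are not congruent to \<open>h a\<close> modulo \<open>e\<close>.
  If \<open>e < 2 a\<close>, there are \<open>h\<close> elements in \<open>(-h a, h a)\<close>, namely \<open>(h - 2) a\<close> and
  \<open>(h - 2 i) a + t\<^sub>i e\<close> for \<open>0 < i < h\<close> with suitable \<open>t\<^sub>i \<in> {-1, 0}\<close>. Hence \<open>e = 2 a\<close>.
\<close>

section \<open>Symmetry of signed sumsets and explicit elements\<close>

lemma uminus_signed_sumset: "v \<in> signed_sumset h A \<Longrightarrow> - v \<in> signed_sumset h A"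
proof -
  assume "v \<in> signed_sumset h A"
  then obtain l where "v = (\<Sum>a\<in>A. l a * a)" "(\<Sum>a\<in>A. \<bar>l a\<bar>) = int h"
    unfolding signed_sumset_def by blast
  then show ?thesis
    unfolding signed_sumset_def
    by (intro CollectI exI[of _ "\<lambda>a. - l a"]) (simp add: sum_negf)
qed

lemma three_term_mem_signed_sumset:
  assumes "finite A" "{p, q, r} \<subseteq> A" "p \<noteq> q" "p \<noteq> r" "q \<noteq> r"
    and "\<bar>x\<bar> + \<bar>y\<bar> + \<bar>z\<bar> = int h"
  shows "x * p + y * q + z * r \<in> signed_sumset h A"
proof -
  define l where "l = (\<lambda>a. if a = p then x else if a = q then y else if a = r then z else 0)"
  have "(\<Sum>a\<in>A. l a * a) = (\<Sum>a\<in>{p, q, r}. l a * a)"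
    using assms by (intro sum.mono_neutral_right) (auto simp: l_def)
  also have "\<dots> = x * p + y * q + z * r"
    using assms by (simp add: l_def)
  finally have 1: "(\<Sum>a\<in>A. l a * a) = x * p + y * q + z * r" .
  have "(\<Sum>a\<in>A. \<bar>l a\<bar>) = (\<Sum>a\<in>{p, q, r}. \<bar>l a\<bar>)"
    using assms by (intro sum.mono_neutral_right) (auto simp: l_def)
  also have "\<dots> = int h"
    using assms by (simp add: l_def)
  finally show ?thesis
    using 1 unfolding signed_sumset_def by (intro CollectI exI[of _ l]) simp
qed

lemma two_term_mem_signed_sumset:
  assumes "finite A" "{p, q} \<subseteq> A" "p \<noteq> q" and "\<bar>x\<bar> + \<bar>y\<bar> = int h"
  shows "x * p + y * q \<in> signed_sumset h A"
proof -
  define l where "l = (\<lambda>a. if a = p then x else if a = q then y else 0)"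
  have "(\<Sum>a\<in>A. l a * a) = (\<Sum>a\<in>{p, q}. l a * a)"
    using assms by (intro sum.mono_neutral_right) (auto simp: l_def)
  also have "\<dots> = x * p + y * q"
    using assms by (simp add: l_def)
  finally have 1: "(\<Sum>a\<in>A. l a * a) = x * p + y * q" .
  have "(\<Sum>a\<in>A. \<bar>l a\<bar>) = (\<Sum>a\<in>{p, q}. \<bar>l a\<bar>)"
    using assms by (intro sum.mono_neutral_right) (auto simp: l_def)
  also have "\<dots> = int h"
    using assms by (simp add: l_def)
  finally show ?thesis
    using 1 unfolding signed_sumset_def by (intro CollectI exI[of _ l]) simp
qed

section \<open>Counting sums along exchange chains\<close>

lemma card_int_progression:
  fixes c d :: int
  assumes "d \<noteq> 0"
  shows "card ((\<lambda>j. c + j * d) ` S) = card S"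
  using assms by (intro card_image) (auto simp: inj_on_def)

text \<open>Each exchange of a \<open>p\<close> for a \<open>q\<close> raises the sum by
  \<open>q - p\<close>. The interval is open on the left so that the bounds for neighbouring pairs
  add up without counting \<open>h * q\<close> twice.\<close>

lemma card_exchange_two:
  fixes X :: "int set" and p q :: int
  assumes "finite X" "p < q"
    and mem: "\<And>x y. 0 \<le> x \<Longrightarrow> 0 \<le> y \<Longrightarrow> x + y = int h \<Longrightarrow> x * p + y * q \<in> X"
  shows "h \<le> card (X \<inter> {int h * p<..int h * q})"
proof -
  let ?S = "(\<lambda>j. int h * p + j * (q - p)) ` {1..int h}"
  have "?S \<subseteq> X \<inter> {int h * p<..int h * q}"
  proof clarify
    fix j assume j: "j \<in> {1..int h}"
    have "int h * p + j * (q - p) = (int h - j) * p + j * q"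
      by (simp add: algebra_simps)
    moreover have "(int h - j) * p + j * q \<in> X"
      using j by (intro mem) auto
    moreover have "0 < j * (q - p)" "j * (q - p) \<le> int h * (q - p)"
      using j assms(2) by (auto intro!: mult_right_mono)
    ultimately show "int h * p + j * (q - p) \<in> X \<inter> {int h * p<..int h * q}"
      by (auto simp: algebra_simps)
  qed
  then have "card ?S \<le> card (X \<inter> {int h * p<..int h * q})"
    using assms(1) by (intro card_mono) auto
  moreover have "card ?S = h"
    using assms(2) by (subst card_int_progression) auto
  ultimately show ?thesis by simp
qed

lemma card_exchange_three:
  fixes X :: "int set" and p q r :: int
  assumes "finite X" "p < q" "q < r" "q - p \<noteq> r - q" "1 \<le> h"
    and mem: "\<And>x y z. 0 \<le> x \<Longrightarrow> 0 \<le> y \<Longrightarrow> 0 \<le> z \<Longrightarrow> x + y + z = int h \<Longrightarrow>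
      x * p + y * q + z * r \<in> X"
  shows "3 * h - 1 \<le> card (X \<inter> {int h * p<..int h * r})"
proof -
  define u w n where "u = q - p" and "w = r - q" and "n = int h"
  have uw: "0 < u" "0 < w" "u \<noteq> w" "1 \<le> n" and qr: "q = p + u" "r = p + u + w"
    using assms by (auto simp: u_def w_def n_def)
  define T where "T = X \<inter> {n * p<..n * r}"
  define S1 where "S1 = (\<lambda>j. n * p + j * u) ` {1..n}"
  define S2 where "S2 = (\<lambda>j. n * q + j * w) ` {1..n}"
  \<comment> \<open>With gaps \<open>u\<close> and \<open>w\<close> the sum lies
    \<open>(y + z) * u + z * w\<close> above \<open>n * p\<close>, so \<open>0 < y + z\<close>
    excludes only the left endpoint.\<close>
  have T_mem: "x * p + y * q + z * r \<in> T"
    if "0 \<le> x" "0 \<le> y" "0 \<le> z" "x + y + z = n" "0 < y + z" for x y z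
  proof -
    have "x * p + y * q + z * r = n * p + ((y + z) * u + z * w)"
      "n * r = x * p + y * q + z * r + (x * (u + w) + y * w)"
      unfolding qr that(4)[symmetric] by (simp_all add: algebra_simps)
    moreover have "0 < (y + z) * u" "0 \<le> z * w" "0 \<le> x * (u + w)" "0 \<le> y * w"
      using that uw by auto
    moreover have "x * p + y * q + z * r \<in> X"
      using that by (intro mem) (auto simp: n_def)
    ultimately show ?thesis by (simp add: T_def)
  qed
  have S1: "S1 \<subseteq> T"
  proof (unfold S1_def, clarify)
    fix j assume "j \<in> {1..n}"
    then have "(n - j) * p + j * q + 0 * r \<in> T" by (intro T_mem) auto
    then show "n * p + j * u \<in> T" by (simp add: qr algebra_simps)
  qed
  have S2: "S2 \<subseteq> T"
  proof (unfold S2_def, clarify)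
    fix j assume "j \<in> {1..n}"
    then have "0 * p + (n - j) * q + j * r \<in> T" by (intro T_mem) auto
    then show "n * q + j * w \<in> T" by (simp add: qr algebra_simps)
  qed
  have le: "v \<le> n * q" if "v \<in> S1" for v
    using that uw by (auto simp: S1_def qr distrib_left)
  have gt: "n * q < v" if "v \<in> S2" for v
    using that uw by (auto simp: S2_def)
  have S12: "S1 \<inter> S2 = {}"
    using le gt by force
  have card12: "card S1 = h" "card S2 = h"
    using uw by (auto simp: S1_def S2_def card_int_progression n_def)
  \<comment> \<open>Not both gaps divide each other; the gap that does not divide the other one gives a
    progression with \<open>h - 1\<close> terms that avoids the exchange chain.\<close>
  have "\<exists>S3. S3 \<subseteq> T \<and> S3 \<inter> S1 = {} \<and> S3 \<inter> S2 = {} \<and> card S3 = h - 1"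
  proof (cases "u dvd w")
    case False
    define S3 where "S3 = (\<lambda>j. (n * p + u + w) + j * u) ` {0..<n - 1}"
    have "S3 \<subseteq> T"
    proof (unfold S3_def, clarify)
      fix j assume "j \<in> {0..<n - 1}"
      then have "(n - 1 - j) * p + j * q + 1 * r \<in> T" by (intro T_mem) auto
      then show "(n * p + u + w) + j * u \<in> T" by (simp add: qr algebra_simps)
    qed
    moreover have "v \<notin> S1" if "v \<in> S3" for v
    proof
      assume "v \<in> S1"
      then obtain i j where "n * p + i * u = (n * p + u + w) + j * u"
        using \<open>v \<in> S3\<close> unfolding S1_def S3_def by auto
      then have "w = u * (i - j - 1)" by (simp add: algebra_simps)
      then show False using False by auto
    qed
    moreover have "v \<notin> S2" if "v \<in> S3" for v
    proof
      assume "v \<in> S2"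
      then obtain i j where ij: "n * q + i * w = (n * p + u + w) + j * u" "1 \<le> i" "j < n - 1"
        using \<open>v \<in> S3\<close> unfolding S2_def S3_def by auto
      \<comment> \<open>All of \<open>S3\<close> lies below \<open>n * q + w\<close>, the least
        element of \<open>S2\<close>.\<close>
      then have "(i - 1) * w + (n - 1 - j) * u = 0" by (simp add: qr algebra_simps)
      moreover have "0 \<le> (i - 1) * w" "0 < (n - 1 - j) * u" using ij uw by auto
      ultimately show False by linarith
    qed
    moreover have "card S3 = h - 1"
      unfolding S3_def using uw by (subst card_int_progression) (auto simp: n_def)
    ultimately show ?thesis by blast
  next
    case True
    then have ndvd: "\<not> w dvd u"
      using uw zdvd_antisym_nonneg[of u w] by auto
    define S3 where "S3 = (\<lambda>j. (n * q - u) + j * w) ` {1..<n}"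
    have "S3 \<subseteq> T"
    proof (unfold S3_def, clarify)
      fix j assume "j \<in> {1..<n}"
      then have "1 * p + (n - 1 - j) * q + j * r \<in> T" by (intro T_mem) auto
      then show "(n * q - u) + j * w \<in> T" by (simp add: qr algebra_simps)
    qed
    moreover have "v \<notin> S2" if "v \<in> S3" for v
    proof
      assume "v \<in> S2"
      then obtain i j where "n * q + i * w = (n * q - u) + j * w"
        using \<open>v \<in> S3\<close> unfolding S2_def S3_def by auto
      then have "u = w * (j - i)" by (simp add: algebra_simps)
      then show False using ndvd by auto
    qed
    moreover have "v \<notin> S1" if "v \<in> S3" for v
    proof
      assume "v \<in> S1"
      then obtain i j where ij: "n * p + i * u = (n * q - u) + j * w" "i \<le> n" "1 \<le> j"
        using \<open>v \<in> S3\<close> unfolding S1_def S3_def by auto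
      \<comment> \<open>\<open>S3\<close> lies above \<open>n * q - u\<close>, so the only element
        of \<open>S1\<close> it could meet is \<open>n * q\<close>, which would make
        \<open>u\<close> a multiple of \<open>w\<close>.\<close>
      then have eq: "j * w = (i - n + 1) * u" by (simp add: qr algebra_simps)
      moreover have "0 < j * w" using ij uw by auto
      ultimately have "0 < i - n + 1" using uw by (simp add: zero_less_mult_iff)
      then have "i = n" using ij by simp
      then have "u = w * j" using eq by (simp add: algebra_simps)
      then show False using ndvd by auto
    qed
    moreover have "card S3 = h - 1"
      unfolding S3_def using uw by (subst card_int_progression) (auto simp: n_def)
    ultimately show ?thesis by blast
  qed
  then obtain S3 where S3: "S3 \<subseteq> T" "S3 \<inter> S1 = {}" "S3 \<inter> S2 = {}" "card S3 = h - 1"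
    by blast
  have finT: "finite T" using assms(1) by (simp add: T_def)
  have fin: "finite S1" "finite S2" "finite S3"
    using S1 S2 S3(1) finT by (auto intro: finite_subset)
  have "card (S3 \<union> (S1 \<union> S2)) = (h - 1) + (h + h)"
    using fin S12 S3 card12 by (simp add: card_Un_disjoint Int_Un_distrib)
  moreover have "card (S3 \<union> (S1 \<union> S2)) \<le> card T"
    using S1 S2 S3 finT by (intro card_mono) auto
  ultimately show ?thesis using assms(5) by (simp add: T_def n_def)
qed

lemma card_Int_interval_split:
  fixes X :: "int set"
  assumes "finite X" "p \<le> q" "q \<le> r"
  shows "card (X \<inter> {p<..r}) = card (X \<inter> {p<..q}) + card (X \<inter> {q<..r})"
proof -
  have "X \<inter> {p<..r} = (X \<inter> {p<..q}) \<union> (X \<inter> {q<..r})" using assms by auto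
  then show ?thesis using assms(1) by (simp add: card_Un_disjoint disjoint_iff)
qed

text \<open>The inequality is carried through the induction because splitting the interval at
  \<open>h * f j\<close> needs its endpoints in order.\<close>

lemma card_exchange_chain:
  fixes X :: "int set" and f :: "nat \<Rightarrow> int"
  assumes "finite X"
    and mono: "\<And>i. Suc i < k \<Longrightarrow> f i < f (Suc i)"
    and mem: "\<And>i x y. Suc i < k \<Longrightarrow> 0 \<le> x \<Longrightarrow> 0 \<le> y \<Longrightarrow> x + y = int h \<Longrightarrow>
      x * f i + y * f (Suc i) \<in> X"
    and "i \<le> j" "j < k"
  shows "int h * f i \<le> int h * f j \<and> h * (j - i) \<le> card (X \<inter> {int h * f i<..int h * f j})"
  using assms(4,5)
proof (induction j rule: dec_induct)
  case base
  then show ?case by simp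
next
  case (step j)
  then have IH: "int h * f i \<le> int h * f j" "h * (j - i) \<le> card (X \<inter> {int h * f i<..int h * f j})"
    by auto
  have le: "int h * f j \<le> int h * f (Suc j)"
    using mono[of j] step by (intro mult_left_mono) auto
  have "h \<le> card (X \<inter> {int h * f j<..int h * f (Suc j)})"
    using step by (intro card_exchange_two assms(1) mono mem) auto
  then show ?case
    using IH le step.hyps card_Int_interval_split[OF assms(1) IH(1) le]
    by (auto simp: Suc_diff_le)
qed

section \<open>Counting by symmetry, and surplus sums of a progression with difference other than
  \<open>2 * a\<close>\<close>

text \<open>The part from \<open>c\<close> upwards, its mirror image and the middle are disjoint.
  The cut is at \<open>h\<close> times the least element when sums between the two chains matter,
  and at 1 when all positive sums are counted together.\<close>

lemma card_symmetric_ge: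
  fixes X :: "int set"
  assumes "finite X" and sym: "\<And>v. v \<in> X \<Longrightarrow> - v \<in> X" and "0 < c"
    and "m \<le> card (X \<inter> {c..})" and "n \<le> card (X \<inter> {-c<..<c})"
  shows "2 * m + n \<le> card X"
proof -
  have "uminus ` (X \<inter> {c..}) = X \<inter> {..-c}"
  proof
    show "X \<inter> {..-c} \<subseteq> uminus ` (X \<inter> {c..})"
    proof
      fix v assume "v \<in> X \<inter> {..-c}"
      then show "v \<in> uminus ` (X \<inter> {c..})"
        using sym[of v] by (intro image_eqI[of _ _ "- v"]) auto
    qed
  qed (use sym in auto)
  then have "card (X \<inter> {..-c}) = card (X \<inter> {c..})"
    by (metis card_image inj_on_inverseI minus_minus)
  moreover have "X = (X \<inter> {c..}) \<union> ((X \<inter> {..-c}) \<union> (X \<inter> {-c<..<c}))"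
    by auto
  then have "card X = card ((X \<inter> {c..}) \<union> ((X \<inter> {..-c}) \<union> (X \<inter> {-c<..<c})))"
    by simp
  moreover have "\<dots> = card (X \<inter> {c..}) + (card (X \<inter> {..-c}) + card (X \<inter> {-c<..<c}))"
    using assms(1,3) by (subst card_Un_disjoint, auto)+
  ultimately show ?thesis using assms(4,5) by simp
qed

lemma card_inner_ge:
  fixes X :: "int set" and a e :: int
  assumes "finite X" "3 \<le> h" "0 < a" "0 < e" "e < 2 * a"
    and mem: "\<And>x y z. \<bar>x\<bar> + \<bar>y\<bar> + \<bar>z\<bar> = int h \<Longrightarrow> x * a + y * (a + e) + z * (a + 2 * e) \<in> X"
  shows "h \<le> card (X \<inter> {-(int h * a)<..<int h * a})"
proof -
  \<comment> \<open>A sum with \<open>h - i\<close> positive and \<open>i\<close> negative summands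
    equals \<open>(h - 2 * i) * a + (y + 2 * z) * e\<close>. Two copies of \<open>-(a + e)\<close>
    against one of \<open>a + 2 * e\<close> cancel \<open>e\<close>. While no \<open>-a\<close> is
    used, an odd \<open>i\<close> leaves one \<open>-(a + e)\<close> unpaired, hence the value -1.
    Once \<open>3 * i > 2 * h\<close>, copies of \<open>-a\<close> fill up the negative summands and
    parity no longer matters.\<close>
  define t :: "nat \<Rightarrow> int" where "t i = (if odd i \<and> 3 * i \<le> 2 * h then -1 else 0)" for i
  define g where "g i = (if i = 0 then (int h - 2) * a else (int h - 2 * int i) * a + t i * e)" for i
  have te: "- e \<le> t i * e" "t i * e \<le> 0" for i
    using assms(4) by (auto simp: t_def)
  \<comment> \<open>The main term drops by \<open>2 * a > e\<close>, while the correction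
    \<open>t i * e\<close> changes by at most \<open>e\<close>. From index 0 to 1 the main term
    stays the same, and \<open>t 1 = -1\<close> gives the drop.\<close>
  have dec: "g (Suc i) < g i" if "Suc i < h" for i
  proof (cases "i = 0")
    case True
    then show ?thesis using assms by (simp add: g_def t_def)
  next
    case False
    have "(int h - 2 * int (Suc i)) * a = (int h - 2 * int i) * a - 2 * a"
      by (simp add: algebra_simps)
    then show ?thesis using False te[of i] te[of "Suc i"] assms(5) by (simp add: g_def)
  qed
  have dec': "g j < g i" if "i < j" "j < h" for i j
    using that
  proof (induction j)
    case (Suc j)
    then show ?case using dec[of j] by (cases "i = j") (auto intro: less_trans)
  qed simp
  have inj: "inj_on g {..<h}"
    by (intro inj_onI) (metis dec' lessThan_iff less_irrefl linorder_neqE_nat)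
  have "g ` {..<h} \<subseteq> X \<inter> {-(int h * a)<..<int h * a}"
  proof clarify
    fix i assume i: "i < h"
    have "g i \<in> X"
    proof -
      consider "i = 0" | "0 < i" "even i" "3 * i \<le> 2 * h" | "odd i" "3 * i \<le> 2 * h" | "0 < i" "2 * h < 3 * i"
        by linarith
      then show ?thesis
      proof cases
        case 1
        then show ?thesis using mem[of "int h - 3" 2 "-1"] assms(2)
          by (simp add: g_def algebra_simps)
      next
        case 2
        then obtain j where "i = 2 * j" by auto
        then show ?thesis using 2 mem[of "int h - 3 * int j" "- 2 * int j" "int j"]
          by (simp add: g_def t_def algebra_simps)
      next
        case 3
        then obtain j where "i = 2 * j + 1" by (auto elim: oddE)
        then show ?thesis using 3 mem[of "int h - 3 * int j - 1" "- 2 * int j - 1" "int j"]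
          by (simp add: g_def t_def algebra_simps)
      next
        case 4
        then show ?thesis
          using i mem[of "2 * int h - 3 * int i" "- 2 * (int h - int i)" "int h - int i"]
          by (simp add: g_def t_def algebra_simps)
      qed
    qed
    moreover have "- (int h * a) < g i \<and> g i < int h * a"
    proof (cases "i = 0")
      case True
      have "0 < (2 * int h - 2) * a" using assms by auto
      then show ?thesis using True assms(3) by (simp add: g_def algebra_simps)
    next
      case False
      \<comment> \<open>For \<open>0 < i < h\<close> the main term keeps distance
        \<open>2 * a > e\<close> from both ends, which absorbs the correction.\<close>
      have "1 * a \<le> int i * a" "1 * a \<le> (int h - int i) * a"
        using False i assms(3) by (auto intro!: mult_right_mono)
      then have "- (int h * a) + 2 * a \<le> (int h - 2 * int i) * a"
        "(int h - 2 * int i) * a \<le> int h * a - 2 * a"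
        by (simp_all add: algebra_simps)
      then show ?thesis using False te[of i] assms(3,5) by (simp add: g_def)
    qed
    ultimately show "g i \<in> X \<inter> {-(int h * a)<..<int h * a}" by simp
  qed
  then have "card (g ` {..<h}) \<le> card (X \<inter> {-(int h * a)<..<int h * a})"
    using assms(1) by (intro card_mono) auto
  then show ?thesis using inj by (simp add: card_image)
qed

text \<open>The chain lies in the residue class of \<open>h * a\<close> modulo \<open>e\<close>, the
  surplus sums in that of \<open>(h - 2) * a\<close>. These classes differ because
  \<open>0 < 2 * a < e\<close>.\<close>

lemma card_outer_ge:
  fixes X :: "int set" and a e :: int
  assumes "finite X" "3 \<le> h" "3 \<le> k" "0 < a" "2 * a < e"
    and mem: "\<And>x y z. \<bar>x\<bar> + \<bar>y\<bar> + \<bar>z\<bar> = int h \<Longrightarrow> x * a + y * (a + e) + z * (a + 2 * e) \<in> X"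
    and chain: "\<And>j. 0 \<le> j \<Longrightarrow> j \<le> int h * (int k - 1) \<Longrightarrow> int h * a + j * e \<in> X"
  shows "h * (k - 1) + 1 + h \<le> card (X \<inter> {1..})"
proof -
  define C where "C = (\<lambda>j. int h * a + j * e) ` {0..int h * (int k - 1)}"
  \<comment> \<open>One summand is \<open>-a\<close>; the other \<open>h - 1\<close> come from
    \<open>a + e\<close> and \<open>a + 2 * e\<close> and contribute between \<open>h - 1\<close>
    and \<open>2 * h - 2\<close> copies of \<open>e\<close>.\<close>
  define D where "D = (\<lambda>j. (int h - 2) * a + j * e) ` {int h - 1..2 * int h - 2}"
  have C: "C \<subseteq> X \<inter> {1..}"
  proof (unfold C_def, clarify)
    fix j assume "j \<in> {0..int h * (int k - 1)}"
    moreover from this have "0 < int h * a" "0 \<le> j * e" using assms by auto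
    ultimately show "int h * a + j * e \<in> X \<inter> {1..}"
      using chain[of j] by auto
  qed
  have D: "D \<subseteq> X \<inter> {1..}"
  proof (unfold D_def, clarify)
    fix j assume j: "j \<in> {int h - 1..2 * int h - 2}"
    then have "-1 * a + (2 * int h - 2 - j) * (a + e) + (j - (int h - 1)) * (a + 2 * e) \<in> X"
      by (intro mem) auto
    moreover have "0 < (int h - 2) * a" "0 \<le> j * e" using j assms by auto
    ultimately show "(int h - 2) * a + j * e \<in> X \<inter> {1..}"
      by (simp add: algebra_simps)
  qed
  have "v \<notin> D" if "v \<in> C" for v
  proof
    assume "v \<in> D"
    then obtain j where "v = (int h - 2) * a + j * e"
      unfolding D_def by blast
    moreover obtain i where "v = int h * a + i * e"
      using \<open>v \<in> C\<close> unfolding C_def by blast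
    ultimately have "int h * a + i * e = (int h - 2) * a + j * e" by simp
    then have "2 * a = e * (j - i)" by (simp add: algebra_simps)
    then have "e dvd 2 * a" by simp
    then show False using assms(4,5) zdvd_imp_le[of e "2 * a"] by simp
  qed
  then have "C \<inter> D = {}" by blast
  moreover have "card C = h * (k - 1) + 1"
  proof -
    have "card C = nat (int h * (int k - 1) + 1)"
      unfolding C_def using assms by (subst card_int_progression) auto
    also have "int h * (int k - 1) + 1 = int (h * (k - 1) + 1)"
      using assms(3) by (simp add: of_nat_diff)
    finally show ?thesis by (simp only: nat_int)
  qed
  moreover have "card D = h"
    unfolding D_def using assms by (subst card_int_progression) auto
  moreover have "finite C" "finite D" by (auto simp: C_def D_def)
  moreover have "card (C \<union> D) \<le> card (X \<inter> {1..})"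
    using C D assms(1) by (intro card_mono) auto
  ultimately show ?thesis by (simp add: card_Un_disjoint)
qed

section \<open>From the cardinality to equal gaps, then to difference \<open>2 * a\<close>\<close>

theorem theorem4:
  fixes h k :: nat and A :: "int set"
  assumes "h \<ge> 3"
    and "finite A" and "card A = k" and "k \<ge> 3"
    and "\<forall>a\<in>A. a > 0"
    and "int (card (signed_sumset h A)) = 2 * int h * int k - int h + 1"
  shows "\<exists>d::int. d > 0 \<and> A = dilation d {2 * int i - 1 | i. i \<in> {1..k}}"
proof -
  define X where "X = signed_sumset h A"
  define f where "f i = sorted_list_of_set A ! i" for i
  have A_eq: "A = f ` {..<k}"
  proof -
    have "A = set (sorted_list_of_set A)" using assms(2) by simp
    also have "\<dots> = f ` {..<k}" by (auto simp: set_conv_nth f_def assms(3))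
    finally show ?thesis .
  qed
  have less: "f i < f j" if "i < j" "j < k" for i j
    using sorted_wrt_nth_less[OF strict_sorted_list_of_set[of A] that(1)] that(2)
    by (simp add: f_def assms(3))
  have inA: "f i \<in> A" if "i < k" for i using that A_eq by blast
  have pos: "0 < f i" if "i < k" for i using inA[OF that] assms(5) by blast
  have kh: "int h \<le> int h * int k" using assms(1,4) by simp
  \<comment> \<open>An infinite set has \<open>card\<close> 0, whereas the prescribed value is
    positive.\<close>
  have finX: "finite X"
    using assms(6) kh by (intro card_ge_0_finite) (auto simp: X_def)
  have cardX: "card X + h = 2 * h * k + 1"
  proof -
    have "int (card X + h) = int (2 * h * k + 1)" using assms(6) by (simp add: X_def)
    then show ?thesis by linarith
  qed
  have hk: "h * k = h * (k - 1) + h" using assms(4) by (cases k) auto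
  have sym: "- v \<in> X" if "v \<in> X" for v
    using that by (simp add: X_def uminus_signed_sumset)
  have mem2: "x * f i + y * f (Suc i) \<in> X" if "Suc i < k" "\<bar>x\<bar> + \<bar>y\<bar> = int h" for i x y
    unfolding X_def using that assms(2) less[of i "Suc i"]
    by (intro two_term_mem_signed_sumset) (auto intro: inA)
  have mem3: "x * f i + y * f (Suc i) + z * f (Suc (Suc i)) \<in> X"
    if "Suc (Suc i) < k" "\<bar>x\<bar> + \<bar>y\<bar> + \<bar>z\<bar> = int h" for i x y z
    unfolding X_def
    using that assms(2) less[of i "Suc i"] less[of i "Suc (Suc i)"] less[of "Suc i" "Suc (Suc i)"]
    by (intro three_term_mem_signed_sumset) (auto intro: inA)
  have chain: "int h * f i \<le> int h * f j \<and> h * (j - i) \<le> card (X \<inter> {int h * f i<..int h * f j})"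
    if "i \<le> j" "j < k" for i j
    using that by (intro card_exchange_chain[of X k f h] finX less mem2) auto
  \<comment> \<open>Restores the endpoint \<open>h * f 0\<close> that the half-open intervals
    omit.\<close>
  have outer: "1 + card (X \<inter> {int h * f 0<..int h * f (k - 1)}) \<le> card (X \<inter> {int h * f 0..})"
  proof -
    have "int h * f 0 + 0 * f 1 \<in> X" using mem2[of 0 "int h" 0] assms(4) by simp
    then have "insert (int h * f 0) (X \<inter> {int h * f 0<..int h * f (k - 1)}) \<subseteq> X \<inter> {int h * f 0..}"
      by auto
    then have "card (insert (int h * f 0) (X \<inter> {int h * f 0<..int h * f (k - 1)})) \<le> card (X \<inter> {int h * f 0..})"
      using finX by (intro card_mono) auto
    then show ?thesis using finX by simp
  qed
  have hf0: "0 < int h * f 0" using pos[of 0] assms(1,4) by auto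
  have ap: "f (Suc i) - f i = f (Suc (Suc i)) - f (Suc i)" if i: "Suc (Suc i) < k" for i
  proof (rule ccontr)
    assume neq: "f (Suc i) - f i \<noteq> f (Suc (Suc i)) - f (Suc i)"
    have tri: "3 * h - 1 \<le> card (X \<inter> {int h * f i<..int h * f (Suc (Suc i))})"
      using i neq assms(1) by (intro card_exchange_three[of X "f i" "f (Suc i)"] finX less mem3) auto
    have le: "int h * f 0 \<le> int h * f i" "int h * f i \<le> int h * f (Suc (Suc i))"
      "int h * f (Suc (Suc i)) \<le> int h * f (k - 1)"
      using chain[of 0 i] chain[of i "Suc (Suc i)"] chain[of "Suc (Suc i)" "k - 1"] i by auto
    have "card (X \<inter> {int h * f 0<..int h * f (k - 1)}) =
        card (X \<inter> {int h * f 0<..int h * f i}) +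
        (card (X \<inter> {int h * f i<..int h * f (Suc (Suc i))}) +
         card (X \<inter> {int h * f (Suc (Suc i))<..int h * f (k - 1)}))"
      using le card_Int_interval_split[OF finX le(1), of "int h * f (k - 1)"]
        card_Int_interval_split[OF finX le(2,3)] by simp
    moreover have "h * i \<le> card (X \<inter> {int h * f 0<..int h * f i})"
      using chain[of 0 i] i by auto
    moreover have "h * (k - 3 - i) \<le> card (X \<inter> {int h * f (Suc (Suc i))<..int h * f (k - 1)})"
      using chain[of "Suc (Suc i)" "k - 1"] i by (simp add: numeral_3_eq_3)
    moreover have "h * k = h * i + 3 * h + h * (k - 3 - i)"
    proof -
      have "k = i + 3 + (k - 3 - i)" using i by simp
      then have "h * k = h * (i + 3 + (k - 3 - i))" by simp
      then show ?thesis by (simp only: distrib_left mult.commute)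
    qed
    \<comment> \<open>The three pieces give \<open>h * k - 1\<close>, and the endpoint makes
      \<open>h * k\<close>. Doubling by symmetry exceeds \<open>2 * h * k - h + 1\<close> since
      \<open>h > 1\<close>.\<close>
    ultimately have "h * k \<le> card (X \<inter> {int h * f 0..})"
      using tri outer assms(1) by linarith
    then have "2 * (h * k) + 0 \<le> card X"
      using hf0 by (intro card_symmetric_ge[of X "int h * f 0"] finX sym) auto
    then show False using cardX assms(1) by simp
  qed
  define a e where "a = f 0" and "e = f 1 - f 0"
  \<comment> \<open>Equality of gaps is a second-order recurrence, so the induction carries two
    consecutive terms.\<close>
  have f_eq: "f i = a + int i * e \<and> (Suc i < k \<longrightarrow> f (Suc i) = a + int (Suc i) * e)"
    if "i < k" for i
    using that
  proof (induction i)
    case 0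
    then show ?case by (simp add: a_def e_def)
  next
    case (Suc i)
    then show ?case using ap[of i] by (auto simp: algebra_simps)
  qed
  have a: "0 < a" using pos[of 0] assms(4) by (simp add: a_def)
  have e: "0 < e" using less[of 0 1] assms(4) by (simp add: e_def)
  have mem: "x * a + y * (a + e) + z * (a + 2 * e) \<in> X" if "\<bar>x\<bar> + \<bar>y\<bar> + \<bar>z\<bar> = int h" for x y z
    using mem3[of 0 x y z] that assms(4) f_eq[of 0] f_eq[of 1] by (simp add: numeral_2_eq_2)
  have "e \<noteq> 2 * a \<Longrightarrow> False"
  proof -
    assume "e \<noteq> 2 * a"
    then consider "e < 2 * a" | "2 * a < e" by linarith
    then show False
    proof cases
      case 1
      have "h * (k - 1) + 1 \<le> card (X \<inter> {int h * a..})"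
        using chain[of 0 "k - 1"] outer assms(4) by (auto simp: a_def)
      moreover have "h \<le> card (X \<inter> {-(int h * a)<..<int h * a})"
        using 1 a e assms(1) by (intro card_inner_ge[of X h a e] finX mem) auto
      ultimately have "2 * (h * (k - 1) + 1) + h \<le> card X"
        using hf0 by (intro card_symmetric_ge[of X "int h * a"] finX sym) (auto simp: a_def)
      \<comment> \<open>The bound is \<open>2 * h * k - h + 2\<close>, one more than the given
        cardinality.\<close>
      then show False using cardX hk by simp
    next
      case 2
      have "int h * a + j * e \<in> X" if j: "0 \<le> j" "j \<le> int h * (int k - 1)" for j
      \<comment> \<open>Division by \<open>h\<close> finds the link of the chain containing
        \<open>j\<close>: \<open>h - s\<close> summands \<open>f i\<close> and \<open>s\<close>
        summands \<open>f (Suc i)\<close>. The last \<open>j\<close> is separate because its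
        quotient \<open>k - 1\<close> has no successor index.\<close>
      proof (cases "j = int h * (int k - 1)")
        case True
        have "0 * f (k - 2) + int h * f (k - 1) \<in> X"
          using mem2[of "k - 2" 0 "int h"] assms(4)
          by (simp add: Suc_diff_Suc numeral_2_eq_2)
        moreover have "f (k - 1) = a + (int k - 1) * e"
          using f_eq[of "k - 1"] assms(4) by (simp add: of_nat_diff)
        ultimately have "int h * (a + (int k - 1) * e) \<in> X" by simp
        then show ?thesis unfolding True by (simp only: distrib_left mult.assoc)
      next
        case False
        define i s where "i = nat (j div int h)" and "s = j mod int h"
        have h0: "0 < int h" using assms(1) by simp
        have i: "int i = j div int h" using j h0 by (simp add: i_def pos_imp_zdiv_nonneg_iff)
        have "j < int h * (int k - 1)" using j False by simp
        moreover have "int h * (j div int h) \<le> j"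
          using minus_mod_eq_mult_div[of j "int h"] pos_mod_sign[OF h0, of j] by linarith
        ultimately have "j div int h < int k - 1"
          using h0 by (meson le_less_trans mult_less_cancel_left_pos)
        then have ik: "Suc i < k" using i by linarith
        have s: "0 \<le> s" "s < int h" using h0 by (auto simp: s_def)
        have js: "j = int h * int i + s" unfolding i s_def by simp
        have "(int h - s) * f i + s * f (Suc i) \<in> X"
          using ik s by (intro mem2) auto
        then show ?thesis using f_eq[of i] ik by (simp add: js algebra_simps)
      qed
      then have "h * (k - 1) + 1 + h \<le> card (X \<inter> {1..})"
        using 2 a assms(1,4) by (intro card_outer_ge[of X h k a e] finX mem) auto
      then have "2 * (h * (k - 1) + 1 + h) + 0 \<le> card X"
        by (intro card_symmetric_ge[of X 1] finX sym) auto
      then show False using cardX hk by simp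
    qed
  qed
  then have "e = 2 * a" by blast
  then have f_odd: "f i = a * (2 * int (Suc i) - 1)" if "i < k" for i
    using f_eq[OF that] by (simp add: algebra_simps)
  have "A = dilation a {2 * int i - 1 | i. i \<in> {1..k}}"
  proof -
    have "A = (\<lambda>i. a * (2 * int (Suc i) - 1)) ` {..<k}"
      unfolding A_eq using f_odd by (intro image_cong) auto
    also have "\<dots> = (\<lambda>i. a * (2 * int i - 1)) ` Suc ` {..<k}"
      by (simp add: image_image)
    also have "Suc ` {..<k} = {1..k}"
      by (simp add: image_Suc_lessThan)
    finally show ?thesis by (auto simp: dilation_def)
  qed
  then show ?thesis using a by blast
qed

end
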